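(* Let $$I=\begin{pmatrix}1&0\\0&1\end{pmatrix},\quad X=\begin{pmatrix}0&1\\1&0\end{pmatrix},\quad Z=\begin{pmatrix}1&0\\0&-1\end{pmatrix},\quad W=\begin{pmatrix}0&-1\\1&0\end{pmatrix},$$ and define $e_1:=X\otimes I$, $e_2:=Z\otimes I$, $e_3:=W\otimes X$, $e_4:=W\otimes Z$ in $\mathrm{Mat}(4,\mathbb R)$ (Kronecker products). Then $$e_1^2=e_2^2=+I_4,\qquad e_3^2=e_4^2=-I_4,\qquad e_re_s=-e_se_r\quad(r\neq s).$$ Hence $e_1,e_2,e_3,e_4$ realize the Clifford algebra $\mathrm{Cl}(2,2;\mathbb R)$ inside $\mathrm{Mat}(4,\mathbb R)$.
   Context: $\mathrm{Cl}(2,2;\mathbb R)$ is the real Clifford algebra on four pairwise anticommuting generators, two of which square to $+1$ and two to $-1$; it has real dimension $16$. "Realize" means that sending the Clifford generators to $e_1,\dots,e_4$ defines an injective unital algebra homomorphism $\mathrm{Cl}(2,2;\mathbb R)\to\mathrm{Mat}(4,\mathbb R)$. $I_4$ is the $4\times4$ identity matrix. *)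

theory Defs
  imports
    "HOL-Library.Poly_Mapping"
    "HOL-Library.Numeral_Type"
    "Jordan_Normal_Form.Matrix"
begin

section \<open>Kronecker product of matrices\<close>

definition kronecker :: "'a::times mat \<Rightarrow> 'a mat \<Rightarrow> 'a mat"  (infixl \<open>\<otimes>\<^sub>k\<close> 70) where
  "A \<otimes>\<^sub>k B = mat (dim_row A * dim_row B) (dim_col A * dim_col B)
     (\<lambda>(i, j). A $$ (i div dim_row B, j div dim_col B) * B $$ (i mod dim_row B, j mod dim_col B))"


section \<open>The free associative real algebra\<close>

text \<open>A copy of the type of lists: the free monoid on the letters, written additively because
  the convolution product on \<^typ>\<open>'a \<Rightarrow>\<^sub>0 'b\<close> is built from the addition of \<^typ>\<open>'a\<close>.\<close>

datatype 'a word = Word (letters: "'a list")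

instantiation word :: (type) monoid_add
begin

definition zero_word :: "'a word" where
  "0 = Word []"

definition plus_word :: "'a word \<Rightarrow> 'a word \<Rightarrow> 'a word" where
  "u + v = Word (letters u @ letters v)"

instance
  by standard (simp_all add: zero_word_def plus_word_def)

end

type_synonym 'a free_algebra = "'a word \<Rightarrow>\<^sub>0 real"

definition var :: "'a \<Rightarrow> 'a free_algebra" where
  "var a = Poly_Mapping.single (Word [a]) 1"

definition const :: "real \<Rightarrow> 'a free_algebra" where
  "const c = Poly_Mapping.single 0 c"

lemma const_add: "const (a + b) = const a + const b"
  by (simp add: const_def single_add)

lemma const_mult: "const (a * b) = const a * const b"
  by (simp add: const_def mult_single)

lemma const_1: "const 1 = 1"
  by (simp add: const_def)

lemma const_commute: "const c * x = x * const c"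
proof (induction x rule: update_induct)
  case const
  show ?case by simp
next
  case (update f k b)
  have eq: "Poly_Mapping.update k b f = f + Poly_Mapping.single k b"
    using update by (intro poly_mapping_eqI)
      (auto simp: lookup_update lookup_add lookup_single when_def in_keys_iff)
  show ?case
    using update by (simp add: eq distrib_left distrib_right const_def mult_single mult.commute)
qed


section \<open>The Clifford algebra \<open>Cl(p, q; \<real>)\<close>\<close>

text \<open>The generators are indexed by \<^typ>\<open>'p + 'q\<close>; those of the form \<^term>\<open>Inl a\<close> square to \<open>+1\<close>
  and those of the form \<^term>\<open>Inr b\<close> square to \<open>-1\<close>. The ideal is two-sided, and closed under
  scalar multiplication since the multipliers include the constants.\<close>

inductive_set clifford_ideal :: "('p + 'q) free_algebra set" where
  square_Inl: "var (Inl a) * var (Inl a) - 1 \<in> clifford_ideal"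
| square_Inr: "var (Inr b) * var (Inr b) + 1 \<in> clifford_ideal"
| anticommute: "r \<noteq> s \<Longrightarrow> var r * var s + var s * var r \<in> clifford_ideal"
| zero: "0 \<in> clifford_ideal"
| add: "x \<in> clifford_ideal \<Longrightarrow> y \<in> clifford_ideal \<Longrightarrow> x + y \<in> clifford_ideal"
| mult: "x \<in> clifford_ideal \<Longrightarrow> u * x * v \<in> clifford_ideal"

definition clifford_rel :: "('p + 'q) free_algebra \<Rightarrow> ('p + 'q) free_algebra \<Rightarrow> bool" where
  "clifford_rel x y \<longleftrightarrow> x - y \<in> clifford_ideal"

lemma clifford_ideal_mult_left: "x \<in> clifford_ideal \<Longrightarrow> u * x \<in> clifford_ideal"
  using clifford_ideal.mult[of x u 1] by simp

lemma clifford_ideal_mult_right: "x \<in> clifford_ideal \<Longrightarrow> x * v \<in> clifford_ideal"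
  using clifford_ideal.mult[of x 1 v] by simp

lemma clifford_ideal_uminus: "x \<in> clifford_ideal \<Longrightarrow> - x \<in> clifford_ideal"
  using clifford_ideal_mult_left[of x "- 1"] by simp

lemma equivp_clifford_rel: "equivp clifford_rel"
proof (rule equivpI)
  show "reflp clifford_rel"
    by (simp add: reflp_def clifford_rel_def clifford_ideal.zero)
  show "symp clifford_rel"
    unfolding symp_def clifford_rel_def using clifford_ideal_uminus by fastforce
  show "transp clifford_rel"
    unfolding transp_def clifford_rel_def using clifford_ideal.add by fastforce
qed

text \<open>For instance, \<open>Cl(2, 2; \<real>)\<close> is \<open>(2, 2) clifford\<close>, where the numeral type \<open>2\<close> has the two
  elements \<open>1\<close> and \<open>2 = 0\<close>.\<close>

quotient_type ('p, 'q) clifford = "('p + 'q) free_algebra" / clifford_rel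
  by (rule equivp_clifford_rel)

lift_definition clifford_gen :: "'p + 'q \<Rightarrow> ('p, 'q) clifford" is var .

text \<open>The class \<^class>\<open>ring_1\<close>, and hence \<^class>\<open>real_algebra_1\<close>, would require \<open>0 \<noteq> 1\<close>,
  which is not immediate from the presentation; the unit is provided by \<^class>\<open>monoid_mult\<close>.\<close>

instantiation clifford :: (type, type) "{real_algebra, monoid_mult}"
begin

lift_definition zero_clifford :: "('a, 'b) clifford" is 0 .

lift_definition one_clifford :: "('a, 'b) clifford" is 1 .

lift_definition plus_clifford :: "('a, 'b) clifford \<Rightarrow> ('a, 'b) clifford \<Rightarrow> ('a, 'b) clifford"
  is "(+)"
  unfolding clifford_rel_def using clifford_ideal.add by (fastforce simp: algebra_simps)

lift_definition uminus_clifford :: "('a, 'b) clifford \<Rightarrow> ('a, 'b) clifford" is uminus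
  unfolding clifford_rel_def using clifford_ideal_uminus by fastforce

lift_definition minus_clifford :: "('a, 'b) clifford \<Rightarrow> ('a, 'b) clifford \<Rightarrow> ('a, 'b) clifford"
  is "(-)"
proof -
  fix x x' y y' :: "('a + 'b) free_algebra"
  assume "clifford_rel x x'" "clifford_rel y y'"
  then have "(x - x') + - (y - y') \<in> clifford_ideal"
    unfolding clifford_rel_def by (intro clifford_ideal.add clifford_ideal_uminus)
  then show "clifford_rel (x - y) (x' - y')"
    by (simp add: clifford_rel_def algebra_simps)
qed

lift_definition times_clifford :: "('a, 'b) clifford \<Rightarrow> ('a, 'b) clifford \<Rightarrow> ('a, 'b) clifford"
  is "(*)"
proof -
  fix x x' y y' :: "('a + 'b) free_algebra"
  assume "clifford_rel x x'" "clifford_rel y y'"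
  then have "(x - x') * y + x' * (y - y') \<in> clifford_ideal"
    unfolding clifford_rel_def
    by (intro clifford_ideal.add clifford_ideal_mult_left clifford_ideal_mult_right)
  then show "clifford_rel (x * y) (x' * y')"
    by (simp add: clifford_rel_def algebra_simps)
qed

lift_definition scaleR_clifford :: "real \<Rightarrow> ('a, 'b) clifford \<Rightarrow> ('a, 'b) clifford"
  is "\<lambda>c x. const c * x"
proof -
  fix c and x y :: "('a + 'b) free_algebra"
  assume "clifford_rel x y"
  then have "const c * (x - y) \<in> clifford_ideal"
    unfolding clifford_rel_def by (rule clifford_ideal_mult_left)
  then show "clifford_rel (const c * x) (const c * y)"
    by (simp add: clifford_rel_def right_diff_distrib)
qed

instance
proof
  fix a b c :: "('a, 'b) clifford" and r s :: real
  have refl: "x = y \<Longrightarrow> clifford_rel x y" for x y :: "('a + 'b) free_algebra"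
    by (simp add: clifford_rel_def clifford_ideal.zero)
  show "a + b + c = a + (b + c)" by transfer (simp add: refl add.assoc)
  show "a + b = b + a" by transfer (simp add: refl add.commute)
  show "0 + a = a" by transfer (simp add: refl)
  show "- a + a = 0" by transfer (simp add: refl)
  show "a - b = a + - b" by transfer (simp add: refl)
  show "a * b * c = a * (b * c)" by transfer (simp add: refl mult.assoc)
  show "1 * a = a" by transfer (simp add: refl)
  show "a * 1 = a" by transfer (simp add: refl)
  show "(a + b) * c = a * c + b * c" by transfer (simp add: refl distrib_right)
  show "a * (b + c) = a * b + a * c" by transfer (simp add: refl distrib_left)
  show "r *\<^sub>R (a + b) = r *\<^sub>R a + r *\<^sub>R b" by transfer (simp add: refl distrib_left)
  show "(r + s) *\<^sub>R a = r *\<^sub>R a + s *\<^sub>R a"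
    by transfer (simp add: refl const_add distrib_right)
  show "r *\<^sub>R s *\<^sub>R a = (r * s) *\<^sub>R a" by transfer (simp add: refl const_mult mult.assoc)
  show "1 *\<^sub>R a = a" by transfer (simp add: refl const_1)
  show "r *\<^sub>R a * b = r *\<^sub>R (a * b)" by transfer (simp add: refl mult.assoc)
  show "a * r *\<^sub>R b = r *\<^sub>R (a * b)"
    by transfer (metis refl const_commute mult.assoc)
qed

end

definition unital_algebra_hom_mat ::
  "nat \<Rightarrow> ('a::{real_algebra, monoid_mult} \<Rightarrow> real mat) \<Rightarrow> bool" where
  "unital_algebra_hom_mat n \<phi> \<longleftrightarrow>
     (\<forall>x. \<phi> x \<in> carrier_mat n n) \<and>
     (\<forall>x y. \<phi> (x + y) = \<phi> x + \<phi> y) \<and>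
     (\<forall>c x. \<phi> (c *\<^sub>R x) = c \<cdot>\<^sub>m \<phi> x) \<and>
     (\<forall>x y. \<phi> (x * y) = \<phi> x * \<phi> y) \<and>
     \<phi> 1 = 1\<^sub>m n"

end

theory Submission
  imports Defs
begin

text \<open>The sixteen ordered products of the generators span \<open>Cl(2, 2; \<real>)\<close>, because the span is closed
  under left multiplication by each generator. Each matrix \<open>e\<^sub>r\<close> acts from the left as a
  signed permutation of the rows, so the entries of a linear combination of the sixteen products
  of the \<open>e\<^sub>r\<close> are read off directly; they determine the sixteen coefficients.\<close>


section \<open>The universal property of the Clifford algebra\<close>

lemma update_eq_add_single:
  fixes f :: "'a \<Rightarrow>\<^sub>0 'b::monoid_add"
  assumes "k \<notin> Poly_Mapping.keys f"
  shows "Poly_Mapping.update k b f = f + Poly_Mapping.single k b"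
  using assms by (intro poly_mapping_eqI)
    (auto simp: lookup_update lookup_add lookup_single when_def in_keys_iff)

text \<open>Every element is a sum of words with coefficients, and each such word grows out of a
  constant, which carries the coefficient, by putting letters in front one at a time.\<close>

lemma free_algebra_induct [case_names scalar add gen]:
  fixes x :: "'a free_algebra"
  assumes scalar: "\<And>c. P (const c)"
    and add: "\<And>x y. P x \<Longrightarrow> P y \<Longrightarrow> P (x + y)"
    and gen: "\<And>a x. P x \<Longrightarrow> P (var a * x)"
  shows "P x"
proof (induction x rule: update_induct)
  case const
  show ?case using scalar[of 0] by (simp add: const_def)
next
  case (update f k b)
  have "P (Poly_Mapping.single (Word ws) b)" for ws
  proof (induction ws)
    case Nil
    show ?case using scalar[of b] by (simp add: const_def zero_word_def)
  next
    case (Cons a ws)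
    have "Poly_Mapping.single (Word (a # ws)) b = var a * Poly_Mapping.single (Word ws) b"
      by (simp add: var_def mult_single plus_word_def)
    with Cons gen show ?case by simp
  qed
  then have "P (Poly_Mapping.single k b)" by (cases k) simp
  with update.IH show ?case
    unfolding update_eq_add_single[OF update.hyps(1)] by (rule add)
qed

text \<open>\<open>free_algebra_induct\<close> passes to the quotient. It serves both the uniqueness
  of homomorphisms and the spanning argument.\<close>

lemma clifford_induct [case_names scalar add gen]:
  fixes x :: "('p, 'q) clifford"
  assumes scalar: "\<And>c. P (c *\<^sub>R 1)"
    and add: "\<And>x y. P x \<Longrightarrow> P y \<Longrightarrow> P (x + y)"
    and gen: "\<And>a x. P x \<Longrightarrow> P (clifford_gen a * x)"
  shows "P x"
proof (induction x rule: clifford.abs_induct)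
  case (1 y)
  show ?case
  proof (induction y rule: free_algebra_induct)
    case (scalar c)
    show ?case using assms(1)[of c] by (simp add: one_clifford_def scaleR_clifford.abs_eq)
  next
    case (add x y)
    then show ?case using assms(2) by (simp flip: plus_clifford.abs_eq)
  next
    case (gen a x)
    then show ?case using assms(3) by (simp add: clifford_gen.abs_eq flip: times_clifford.abs_eq)
  qed
qed

lemma clifford_gen_square_Inl: "clifford_gen (Inl a) * clifford_gen (Inl a) = 1"
  by transfer (simp add: clifford_rel_def clifford_ideal.square_Inl)

lemma clifford_gen_square_Inr: "clifford_gen (Inr b) * clifford_gen (Inr b) = - 1"
  by transfer (simp add: clifford_rel_def clifford_ideal.square_Inr)

lemma clifford_gen_anticommute:
  "r \<noteq> s \<Longrightarrow> clifford_gen r * clifford_gen s = - (clifford_gen s * clifford_gen r)"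
  by transfer (simp add: clifford_rel_def clifford_ideal.anticommute)

lemma unital_algebra_hom_mat_clifford_eqI:
  assumes "unital_algebra_hom_mat n \<phi>" "unital_algebra_hom_mat n \<psi>"
    and "\<And>a. \<phi> (clifford_gen a) = \<psi> (clifford_gen a)"
  shows "\<phi> = \<psi>"
proof
  show "\<phi> x = \<psi> x" for x
    by (induction x rule: clifford_induct)
      (use assms in \<open>simp_all add: unital_algebra_hom_mat_def\<close>)
qed

section \<open>Evaluation of noncommutative polynomials at matrices\<close>

definition eval_word :: "nat \<Rightarrow> ('a \<Rightarrow> real mat) \<Rightarrow> 'a word \<Rightarrow> real mat" where
  "eval_word n f w = foldr (\<lambda>a M. f a * M) (letters w) (1\<^sub>m n)"

text \<open>The sum is formed inside each entry because matrices of all sizes share one type, where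
  an empty sum would have no definite size.\<close>

definition free_eval :: "nat \<Rightarrow> ('a \<Rightarrow> real mat) \<Rightarrow> 'a free_algebra \<Rightarrow> real mat" where
  "free_eval n f x = mat n n
     (\<lambda>ij. \<Sum>w\<in>Poly_Mapping.keys x. Poly_Mapping.lookup x w * eval_word n f w $$ ij)"

lemma eval_word_Cons: "eval_word n f (Word [a] + w) = f a * eval_word n f w"
  by (simp add: eval_word_def plus_word_def)

lemma free_eval_carrier [simp]: "free_eval n f x \<in> carrier_mat n n"
  by (simp add: free_eval_def)

text \<open>Cancellation can make the keys of a sum or difference fewer than the union of the keys.
  A common index set lets additivity be checked term by term.\<close>

lemma free_eval_superset:
  assumes "finite S" "Poly_Mapping.keys x \<subseteq> S"
  shows "free_eval n f x = mat n n (\<lambda>ij. \<Sum>w\<in>S. Poly_Mapping.lookup x w * eval_word n f w $$ ij)"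
proof -
  have "(\<Sum>w\<in>Poly_Mapping.keys x. Poly_Mapping.lookup x w * eval_word n f w $$ ij)
      = (\<Sum>w\<in>S. Poly_Mapping.lookup x w * eval_word n f w $$ ij)" for ij
    using assms by (intro sum.mono_neutral_left) (auto simp: in_keys_iff)
  then show ?thesis by (simp add: free_eval_def)
qed

lemma free_eval_add: "free_eval n f (x + y) = free_eval n f x + free_eval n f y"
proof -
  have "Poly_Mapping.keys (x + y) \<subseteq> Poly_Mapping.keys x \<union> Poly_Mapping.keys y"
    by (rule Poly_Mapping.keys_add)
  then show ?thesis
    by (intro eq_matI)
      (simp_all add: free_eval_superset[where S = "Poly_Mapping.keys x \<union> Poly_Mapping.keys y"]
        lookup_add distrib_right sum.distrib)
qed

lemma free_eval_diff: "free_eval n f (x - y) = free_eval n f x - free_eval n f y"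
proof -
  have "Poly_Mapping.keys (x - y) \<subseteq> Poly_Mapping.keys x \<union> Poly_Mapping.keys y"
    by (auto simp: in_keys_iff lookup_minus)
  then show ?thesis
    by (intro eq_matI)
      (simp_all add: free_eval_superset[where S = "Poly_Mapping.keys x \<union> Poly_Mapping.keys y"]
        lookup_minus left_diff_distrib sum_subtractf)
qed

lemma free_eval_0 [simp]: "free_eval n f 0 = 0\<^sub>m n n"
  by (intro eq_matI) (simp_all add: free_eval_def)

context
  fixes n :: nat and f :: "'a \<Rightarrow> real mat"
  assumes f_carrier [simp]: "\<And>a. f a \<in> carrier_mat n n"
begin

lemma eval_word_carrier [simp]: "eval_word n f w \<in> carrier_mat n n"
proof -
  have "foldr (\<lambda>a M. f a * M) ws (1\<^sub>m n) \<in> carrier_mat n n" for ws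
    by (induction ws) (auto intro: mult_carrier_mat[where n = n])
  then show ?thesis by (simp add: eval_word_def)
qed

lemma free_eval_single: "free_eval n f (Poly_Mapping.single w c) = c \<cdot>\<^sub>m eval_word n f w"
  by (intro eq_matI)
    (simp_all add: free_eval_superset[where S = "{w}"] carrier_matD[OF eval_word_carrier])

lemma free_eval_const: "free_eval n f (const c) = c \<cdot>\<^sub>m 1\<^sub>m n"
  by (simp add: const_def free_eval_single eval_word_def zero_word_def)

lemma one_smult_mat: "(1 :: real) \<cdot>\<^sub>m A = A"
  by (intro eq_matI) simp_all

lemma free_eval_1 [simp]: "free_eval n f 1 = 1\<^sub>m n"
  using free_eval_const[of 1] by (simp add: const_1 one_smult_mat)

lemma free_eval_var [simp]: "free_eval n f (var a) = f a"
  by (simp add: var_def free_eval_single eval_word_def right_mult_one_mat[OF f_carrier] one_smult_mat)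

text \<open>Prepending a letter to a word multiplies its value by \<open>f a\<close> on the left.
  The induction adds one word at a time, since a step from \<open>x\<close> to
  \<open>var b * x\<close> would lead to \<open>var a * (var b * x)\<close>, about which the
  induction hypothesis says nothing.\<close>

lemma free_eval_var_mult: "free_eval n f (var a * x) = f a * free_eval n f x"
proof (induction x rule: update_induct)
  case const
  show ?case by (simp add: right_mult_zero_mat[OF f_carrier])
next
  case (update g k b)
  have "free_eval n f (var a * Poly_Mapping.single k b)
      = f a * free_eval n f (Poly_Mapping.single k b)"
    by (simp add: var_def mult_single free_eval_single eval_word_Cons
        mult_smult_distrib[OF f_carrier eval_word_carrier])
  with update.IH show ?case
    by (simp add: update_eq_add_single[OF update.hyps(1)] distrib_left free_eval_add
        mult_add_distrib_mat[where nr = n and n = n and nc = n])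
qed

lemma free_eval_const_mult: "free_eval n f (const c * x) = c \<cdot>\<^sub>m free_eval n f x"
proof (induction x rule: free_algebra_induct)
  case (scalar d)
  show ?case by (intro eq_matI) (simp_all add: free_eval_const flip: const_mult)
next
  case (add x y)
  then show ?case
    by (simp add: distrib_left free_eval_add add_smult_distrib_left_mat[where nr = n and nc = n])
next
  case (gen a x)
  \<comment> \<open>Constants are central, so \<open>c\<close> can move inward to \<open>x\<close>,
    where the induction hypothesis applies.\<close>
  have "const c * (var a * x) = var a * (const c * x)"
    by (metis const_commute mult.assoc)
  with gen show ?case
    by (simp add: free_eval_var_mult mult_smult_distrib[OF f_carrier free_eval_carrier])
qed

text \<open>Induction on the left factor: by associativity its leading letter is handled by
  \<open>free_eval_var_mult\<close> and the rest by the induction hypothesis.\<close>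

lemma free_eval_mult: "free_eval n f (x * y) = free_eval n f x * free_eval n f y"
proof (induction x rule: free_algebra_induct)
  case (scalar c)
  show ?case
    by (simp add: free_eval_const_mult free_eval_const left_mult_one_mat[OF free_eval_carrier]
        mult_smult_assoc_mat[where n = n and nr = n and nc = n])
next
  case (add x x')
  then show ?case
    by (simp add: distrib_right free_eval_add add_mult_distrib_mat[where nr = n and n = n and nc = n])
next
  case (gen a x)
  then show ?case
    by (simp add: mult.assoc free_eval_var_mult
        assoc_mult_mat[OF f_carrier free_eval_carrier free_eval_carrier])
qed

end

text \<open>Evaluation is additive and multiplicative, so it kills the two-sided ideal once it kills
  the three families of relators, which is what the hypotheses on \<open>f\<close> say.\<close>

lemma free_eval_clifford_ideal:
  fixes f :: "'p + 'q \<Rightarrow> real mat"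
  assumes f_carrier [simp]: "\<And>a. f a \<in> carrier_mat n n"
    and "\<And>a. f (Inl a) * f (Inl a) = 1\<^sub>m n"
    and "\<And>b. f (Inr b) * f (Inr b) = - 1\<^sub>m n"
    and "\<And>r s. r \<noteq> s \<Longrightarrow> f r * f s = - (f s * f r)"
    and "x \<in> clifford_ideal"
  shows "free_eval n f x = 0\<^sub>m n n"
  using assms(5)
proof induction
  case (square_Inl a)
  show ?case by (simp add: free_eval_diff free_eval_mult assms(2))
next
  case (square_Inr b)
  show ?case by (simp add: free_eval_add free_eval_mult assms(3))
next
  case (anticommute r s)
  have "f s * f r \<in> carrier_mat n n" by (rule mult_carrier_mat[OF f_carrier f_carrier])
  with anticommute show ?case by (simp add: free_eval_add free_eval_mult assms(4)[of r s])
next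
  case zero
  show ?case by simp
next
  case (add x y)
  then show ?case by (simp add: free_eval_add)
next
  case (mult x u v)
  then show ?case
    by (simp add: free_eval_mult right_mult_zero_mat[OF free_eval_carrier]
        left_mult_zero_mat[OF free_eval_carrier])
qed

text \<open>The existence half of the universal property: evaluation at \<open>f\<close> vanishes on
  the ideal and therefore descends to the quotient.\<close>

lemma clifford_lift_exists:
  fixes f :: "'p + 'q \<Rightarrow> real mat"
  assumes f_carrier: "\<And>a. f a \<in> carrier_mat n n"
    and "\<And>a. f (Inl a) * f (Inl a) = 1\<^sub>m n"
    and "\<And>b. f (Inr b) * f (Inr b) = - 1\<^sub>m n"
    and "\<And>r s. r \<noteq> s \<Longrightarrow> f r * f s = - (f s * f r)"
  obtains \<phi> :: "('p, 'q) clifford \<Rightarrow> real mat"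
  where "unital_algebra_hom_mat n \<phi>" "\<And>a. \<phi> (clifford_gen a) = f a"
proof
  define \<phi> where "\<phi> x = free_eval n f (rep_clifford x)" for x
  \<comment> \<open>The chosen representative is immaterial. Every clause below then reduces to the
    corresponding law of \<open>free_eval\<close>.\<close>
  have abs: "\<phi> (abs_clifford y) = free_eval n f y" for y
  proof -
    let ?y' = "rep_clifford (abs_clifford y)"
    have "clifford_rel ?y' y"
      by (simp add: Quotient3_rep_abs[OF Quotient3_clifford] equivp_reflp[OF equivp_clifford_rel])
    then have "free_eval n f ?y' - free_eval n f y = 0\<^sub>m n n"
      by (simp add: clifford_rel_def free_eval_clifford_ideal[OF assms] flip: free_eval_diff)
    then have "(free_eval n f ?y' - free_eval n f y) $$ (i, j) = 0" if "i < n" "j < n" for i j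
      using that by simp
    then show ?thesis
      by (intro eq_matI) (auto simp: \<phi>_def free_eval_def)
  qed
  show "unital_algebra_hom_mat n \<phi>"
    unfolding unital_algebra_hom_mat_def
  proof (intro conjI allI)
    show "\<phi> x \<in> carrier_mat n n" for x by (simp add: \<phi>_def)
    show "\<phi> (x + y) = \<phi> x + \<phi> y" for x y
      by (induction x rule: clifford.abs_induct, induction y rule: clifford.abs_induct)
        (simp add: plus_clifford.abs_eq abs free_eval_add)
    show "\<phi> (x * y) = \<phi> x * \<phi> y" for x y
      by (induction x rule: clifford.abs_induct, induction y rule: clifford.abs_induct)
        (simp add: times_clifford.abs_eq abs free_eval_mult f_carrier)
    show "\<phi> (c *\<^sub>R x) = c \<cdot>\<^sub>m \<phi> x" for c x
      by (induction x rule: clifford.abs_induct)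
        (simp add: scaleR_clifford.abs_eq abs free_eval_const_mult f_carrier)
    show "\<phi> 1 = 1\<^sub>m n"
      by (simp add: one_clifford_def abs f_carrier)
  qed
  show "\<phi> (clifford_gen a) = f a" for a
    by (simp add: clifford_gen.abs_eq abs f_carrier)
qed


section \<open>Spanning by ordered products of generators\<close>

text \<open>The linear span of the products of sublists, with factors in list order:
  \<open>a\<close> gathers the products without \<open>g\<close>, and \<open>b\<close> the cofactors
  of those starting with \<open>g\<close>. Thus n generators give 2^n coefficients.\<close>

fun ordered_span :: "'a::{real_algebra, monoid_mult} list \<Rightarrow> 'a set" where
  "ordered_span [] = range (\<lambda>c. c *\<^sub>R 1)"
| "ordered_span (g # gs) = {a + g * b |a b. a \<in> ordered_span gs \<and> b \<in> ordered_span gs}"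

lemma scalar_in_ordered_span: "c *\<^sub>R 1 \<in> ordered_span gs"
proof (induction gs arbitrary: c)
  case Nil
  show ?case by (simp only: ordered_span.simps) (rule rangeI)
next
  case (Cons g gs)
  then have "c *\<^sub>R 1 \<in> ordered_span gs" "0 *\<^sub>R 1 \<in> ordered_span gs" by blast+
  moreover have "c *\<^sub>R 1 = c *\<^sub>R 1 + g * (0 *\<^sub>R 1)" by simp
  ultimately show ?case by (simp only: ordered_span.simps) blast
qed

lemma ordered_span_add:
  "x \<in> ordered_span gs \<Longrightarrow> y \<in> ordered_span gs \<Longrightarrow> x + y \<in> ordered_span gs"
proof (induction gs arbitrary: x y)
  case Nil
  then show ?case by (auto simp flip: scaleR_add_left)
next
  case (Cons g gs)
  then obtain a b a' b' where "x = a + g * b" "y = a' + g * b'"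
    and "a \<in> ordered_span gs" "b \<in> ordered_span gs" "a' \<in> ordered_span gs" "b' \<in> ordered_span gs"
    by auto
  moreover from this have "x + y = (a + a') + g * (b + b')" by (simp add: algebra_simps)
  ultimately show ?case using Cons.IH by (simp only: ordered_span.simps) blast
qed

lemma ordered_span_uminus: "x \<in> ordered_span gs \<Longrightarrow> - x \<in> ordered_span gs"
proof (induction gs arbitrary: x)
  case Nil
  then obtain c where "x = c *\<^sub>R 1" by auto
  then have "- x = (- c) *\<^sub>R 1" by simp
  then show ?case by (simp only: ordered_span.simps) (rule rangeI)
next
  case (Cons g gs)
  then obtain a b where "x = a + g * b" "a \<in> ordered_span gs" "b \<in> ordered_span gs"
    by auto
  moreover from this have "- x = - a + g * (- b)" by simp
  ultimately show ?case using Cons.IH by (simp only: ordered_span.simps) blast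
qed

text \<open>The new factor moves right past the other generators, changing sign each time, until it
  reaches its own place in the order. There it is inserted, or it cancels up to sign against the
  copy already present.\<close>

lemma ordered_span_mult_left:
  assumes "\<And>g. g \<in> set gs \<Longrightarrow> g * g = 1 \<or> g * g = - 1"
    and "\<And>g h. g \<in> set gs \<Longrightarrow> h \<in> set gs \<Longrightarrow> g \<noteq> h \<Longrightarrow> g * h = - (h * g)"
    and "g \<in> set gs" "x \<in> ordered_span gs"
  shows "g * x \<in> ordered_span gs"
  using assms
proof (induction gs arbitrary: x)
  case Nil
  from Nil.prems(3) show ?case by simp
next
  case (Cons h gs)
  from Cons.prems(4) obtain a b where x: "x = a + h * b"
    and ab: "a \<in> ordered_span gs" "b \<in> ordered_span gs"
    by auto
  show ?case
  proof (cases "g = h")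
    case True
    \<comment> \<open>The two parts exchange roles: \<open>a\<close> acquires the generator and
      \<open>b\<close> loses it.\<close>
    have "g * x = (g * g) * b + h * a"
      by (simp only: x True distrib_left mult.assoc add.commute)
    moreover have "(g * g) * b \<in> ordered_span gs"
      using Cons.prems(1)[OF Cons.prems(3)]
    proof
      assume "g * g = - 1"
      with ab(2) show ?thesis by (simp add: ordered_span_uminus)
    qed (use ab in simp)
    ultimately show ?thesis using ab by (simp only: ordered_span.simps) blast
  next
    case False
    have anti: "g * h = - (h * g)"
      by (rule Cons.prems(2)) (use Cons.prems(3) False in simp_all)
    have "g * (h * b) = - (h * (g * b))"
      by (simp only: anti mult_minus_left flip: mult.assoc)
    \<comment> \<open>Now \<open>g\<close> acts only on elements of the span of the tail, and the
      tail still contains \<open>g\<close>.\<close>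
    then have "g * x = g * a + h * (- (g * b))" by (simp add: x distrib_left)
    moreover have "g * c \<in> ordered_span gs" if "c \<in> ordered_span gs" for c
    proof (rule Cons.IH)
      show "k * k = 1 \<or> k * k = - 1" if "k \<in> set gs" for k
        using that by (intro Cons.prems(1)) simp
      show "k * l = - (l * k)" if "k \<in> set gs" "l \<in> set gs" "k \<noteq> l" for k l
        by (rule Cons.prems(2)) (use that in simp_all)
      show "g \<in> set gs" using Cons.prems(3) False by simp
    qed (fact that)
    then have "g * a \<in> ordered_span gs" "- (g * b) \<in> ordered_span gs"
      using ab by (blast intro: ordered_span_uminus)+
    ultimately show ?thesis by (simp only: ordered_span.simps) blast
  qed
qed

text \<open>The span contains the scalars and is closed under sums and under left multiplication by
  generators, so \<open>clifford_induct\<close> applies.\<close>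

lemma clifford_in_ordered_span:
  fixes x :: "('p, 'q) clifford"
  assumes "set rs = UNIV"
  shows "x \<in> ordered_span (map clifford_gen rs)"
proof (induction x rule: clifford_induct)
  case (gen a x)
  show ?case
  proof (rule ordered_span_mult_left)
    show "g * g = 1 \<or> g * g = - 1" if "g \<in> set (map clifford_gen rs)" for g :: "('p, 'q) clifford"
    proof -
      from that obtain r where "g = clifford_gen r" by auto
      then show ?thesis by (cases r) (simp_all add: clifford_gen_square_Inl clifford_gen_square_Inr)
    qed
    show "g * h = - (h * g)"
      if "g \<in> set (map clifford_gen rs)" "h \<in> set (map clifford_gen rs)" "g \<noteq> h"
      for g h :: "('p, 'q) clifford"
    proof -
      from that obtain r s where rs: "g = clifford_gen r" "h = clifford_gen s" by auto
      with that(3) have "r \<noteq> s" by auto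
      then show ?thesis unfolding rs by (rule clifford_gen_anticommute)
    qed
  qed (use gen assms in auto)
qed (auto intro: scalar_in_ordered_span ordered_span_add)


section \<open>The representation on four-dimensional space\<close>

lemma index_mult_mat4:
  assumes "A \<in> carrier_mat 4 4" "B \<in> carrier_mat 4 4" "i < 4" "j < 4"
  shows "(A * B) $$ (i, j) = A $$ (i, 0) * B $$ (0, j) + A $$ (i, 1) * B $$ (1, j)
    + A $$ (i, 2) * B $$ (2, j) + A $$ (i, 3) * B $$ (3, j)"
  using assms by (simp add: scalar_prod_def eval_nat_numeral)

text \<open>The indices range over explicit sets, so that \<open>auto\<close> splits an equation
  into sixteen numerical cases.\<close>

lemma mat4_eqI:
  assumes "A \<in> carrier_mat 4 4" "B \<in> carrier_mat 4 4"
    and "\<And>i j. i \<in> {0, 1, 2, 3} \<Longrightarrow> j \<in> {0, 1, 2, 3} \<Longrightarrow> A $$ (i, j) = B $$ (i, j)"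
  shows "A = B"
  using assms(1,2) by (intro eq_matI assms(3)) auto

lemma UNIV_numeral_2: "UNIV = {1, 2 :: 2}"
proof -
  have "x = 1 \<or> x = 2" for x :: 2
  proof (cases x)
    case (of_int z)
    then have "z = 0 \<or> z = 1" by auto
    \<comment> \<open>In the type \<open>2\<close> the numeral \<open>2\<close> equals
      \<open>0\<close>, so \<open>z = 0\<close> gives the second alternative.\<close>
    with of_int show ?thesis by auto
  qed
  then show ?thesis by auto
qed

text \<open>The equivalence over all \<open>\<psi>\<close> packs existence and uniqueness together,
  so injectivity is asserted of the very map that the generators determine.\<close>

theorem lemma5p1:
  fixes I X Z W :: "real mat" and e :: "nat \<Rightarrow> real mat"
  assumes I: "I = mat_of_rows_list 2 [[1, 0], [0, 1]]"
    and X: "X = mat_of_rows_list 2 [[0, 1], [1, 0]]"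
    and Z: "Z = mat_of_rows_list 2 [[1, 0], [0, -1]]"
    and W: "W = mat_of_rows_list 2 [[0, -1], [1, 0]]"
    and e1: "e 1 = X \<otimes>\<^sub>k I"
    and e2: "e 2 = Z \<otimes>\<^sub>k I"
    and e3: "e 3 = W \<otimes>\<^sub>k X"
    and e4: "e 4 = W \<otimes>\<^sub>k Z"
  shows "(\<forall>r\<in>{1..4}. e r \<in> carrier_mat 4 4) \<and>
    e 1 * e 1 = 1\<^sub>m 4 \<and> e 2 * e 2 = 1\<^sub>m 4 \<and>
    e 3 * e 3 = - 1\<^sub>m 4 \<and> e 4 * e 4 = - 1\<^sub>m 4 \<and>
    (\<forall>r\<in>{1..4}. \<forall>s\<in>{1..4}. r \<noteq> s \<longrightarrow> e r * e s = - (e s * e r)) \<and>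
    (\<exists>\<phi> :: (2, 2) clifford \<Rightarrow> real mat.
       (\<forall>\<psi>. unital_algebra_hom_mat 4 \<psi> \<and>
            \<psi> (clifford_gen (Inl 1)) = e 1 \<and> \<psi> (clifford_gen (Inl 2)) = e 2 \<and>
            \<psi> (clifford_gen (Inr 1)) = e 3 \<and> \<psi> (clifford_gen (Inr 2)) = e 4
          \<longleftrightarrow> \<psi> = \<phi>) \<and>
       inj \<phi>)"
proof -

  \<comment> \<open>The explicit matrices and their relations\<close>
  let ?M1 = "[[0,0,1,0], [0,0,0,1], [1,0,0,0], [0,1,0,0]] :: real list list"
  let ?M2 = "[[1,0,0,0], [0,1,0,0], [0,0,-1,0], [0,0,0,-1]] :: real list list"
  let ?M3 = "[[0,0,0,-1], [0,0,-1,0], [0,1,0,0], [1,0,0,0]] :: real list list"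
  let ?M4 = "[[0,0,-1,0], [0,0,0,1], [1,0,0,0], [0,-1,0,0]] :: real list list"
  have rows2: "mat_of_rows_list 2 [a, b] = mat 2 2 (\<lambda>(i, j). [a, b] ! i ! j)" for a b :: "real list"
    by (simp add: mat_of_rows_list_def numeral_2_eq_2)
  have rows4: "mat_of_rows_list 4 [a, b, c, d] = mat 4 4 (\<lambda>(i, j). [a, b, c, d] ! i ! j)"
    for a b c d :: "real list"
    by (simp add: mat_of_rows_list_def eval_nat_numeral)
  have E: "e 1 = mat_of_rows_list 4 ?M1" "e 2 = mat_of_rows_list 4 ?M2"
    "e 3 = mat_of_rows_list 4 ?M3" "e 4 = mat_of_rows_list 4 ?M4"
    unfolding e1 e2 e3 e4 I X Z W
    by (rule mat4_eqI; auto simp: kronecker_def rows2 rows4 simp del: One_nat_def)+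
  have four: "{1..4} = {1, 2, 3, 4 :: nat}" by auto
  have carrier: "e r \<in> carrier_mat 4 4" if "r \<in> {1..4}" for r
    using that unfolding four by (auto simp: E rows4 simp del: One_nat_def)
  have carriers: "e 1 \<in> carrier_mat 4 4" "e 2 \<in> carrier_mat 4 4"
    "e 3 \<in> carrier_mat 4 4" "e 4 \<in> carrier_mat 4 4"
    by (rule carrier; simp)+
  \<comment> \<open>The generators are numbered from 1 and list positions from 0, hence
    \<open>r - 1\<close>.\<close>
  define E_index where "E_index r i j = [?M1, ?M2, ?M3, ?M4] ! (r - 1) ! i ! j" for r i j :: nat
  have index: "e r $$ (i, j) = E_index r i j" if "r \<in> {1..4}" "i < 4" "j < 4" for r i j
    using that unfolding four
    by (auto simp: E rows4 E_index_def simp del: One_nat_def)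
  \<comment> \<open>\<open>B\<close> stays arbitrary: it is another \<open>e s\<close> in the
    relations and an image \<open>\<phi> x\<close> in the injectivity argument.\<close>
  have product: "(e r * B) $$ (i, j) = E_index r i 0 * B $$ (0, j) + E_index r i 1 * B $$ (1, j)
    + E_index r i 2 * B $$ (2, j) + E_index r i 3 * B $$ (3, j)"
    if "r \<in> {1..4}" "i < 4" "j < 4" "B \<in> carrier_mat 4 4" for r i j B
    using that by (simp add: index_mult_mat4 carrier index)
  have squares: "e 1 * e 1 = 1\<^sub>m 4" "e 2 * e 2 = 1\<^sub>m 4"
    "e 3 * e 3 = - 1\<^sub>m 4" "e 4 * e 4 = - 1\<^sub>m 4"
    by (rule mat4_eqI;
        use carriers in \<open>auto simp: product index E_index_def simp del: One_nat_def index_mult_mat(1)\<close>)+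
  have anticommute: "e r * e s = - (e s * e r)" if "r \<in> {1..4}" "s \<in> {1..4}" "r \<noteq> s" for r s
  proof (rule mat4_eqI)
    show "e r * e s \<in> carrier_mat 4 4" "- (e s * e r) \<in> carrier_mat 4 4"
      using that carrier by (auto intro!: mult_carrier_mat)
    fix i j :: nat
    assume "i \<in> {0, 1, 2, 3}" "j \<in> {0, 1, 2, 3}"
    then show "(e r * e s) $$ (i, j) = (- (e s * e r)) $$ (i, j)"
      using that carriers unfolding four
      by (auto simp: product index E_index_def simp del: One_nat_def index_mult_mat(1))
  qed

  \<comment> \<open>The homomorphism and its uniqueness\<close>
  define k :: "2 + 2 \<Rightarrow> nat"
    where "k = case_sum (\<lambda>a. if a = 1 then 1 else 2) (\<lambda>b. if b = 1 then 3 else 4)"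
  have k [simp]: "k (Inl 1) = 1" "k (Inl 2) = 2" "k (Inr 1) = 3" "k (Inr 2) = 4"
    by (simp_all add: k_def)
  \<comment> \<open>The type \<open>2\<close> has only the elements \<open>1\<close> and
    \<open>2\<close>, so the \<open>else\<close> branches of \<open>k\<close> stand for the index
    \<open>2\<close>, and two checks settle a claim about all indices.\<close>
  have all2: "P 1 \<Longrightarrow> P 2 \<Longrightarrow> P a" for P and a :: 2
    using UNIV_numeral_2 by (metis UNIV_I insertE singletonD)
  have k_range: "k r \<in> {1..4}" for r
    by (cases r) (simp_all add: k_def)
  \<comment> \<open>\<open>clifford_lift_exists\<close> asks for anticommutation at distinct
    indices, whereas \<open>anticommute\<close> gives it at distinct numbers.\<close>
  have k_inj: "k r \<noteq> k s" if "r \<noteq> s" for r s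
  proof -
    have "a = b" if "a = 1 \<longleftrightarrow> b = 1" for a b :: 2
      using that UNIV_numeral_2 by (metis UNIV_I insertE singletonD)
    with that show ?thesis
      by (cases r; cases s) (auto simp: k_def split: if_splits)
  qed
  obtain \<phi> :: "(2, 2) clifford \<Rightarrow> real mat"
    where hom: "unital_algebra_hom_mat 4 \<phi>" and gen: "\<And>r. \<phi> (clifford_gen r) = e (k r)"
  proof (rule clifford_lift_exists)
    show "e (k r) \<in> carrier_mat 4 4" for r by (rule carrier[OF k_range])
    show "e (k (Inl a)) * e (k (Inl a)) = 1\<^sub>m 4" for a
      by (rule all2[where a = a]) (simp_all only: k squares)
    show "e (k (Inr b)) * e (k (Inr b)) = - 1\<^sub>m 4" for b
      by (rule all2[where a = b]) (simp_all only: k squares)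
    show "e (k r) * e (k s) = - (e (k s) * e (k r))" if "r \<noteq> s" for r s
      by (rule anticommute[OF k_range k_range k_inj[OF that]])
  qed (rule that)
  have unique: "\<psi> = \<phi>"
    if "unital_algebra_hom_mat 4 \<psi>"
      "\<psi> (clifford_gen (Inl 1)) = e 1" "\<psi> (clifford_gen (Inl 2)) = e 2"
      "\<psi> (clifford_gen (Inr 1)) = e 3" "\<psi> (clifford_gen (Inr 2)) = e 4" for \<psi>
  proof (rule unital_algebra_hom_mat_clifford_eqI[OF that(1) hom])
    have "\<psi> (clifford_gen (Inl a)) = \<phi> (clifford_gen (Inl a))"
      "\<psi> (clifford_gen (Inr a)) = \<phi> (clifford_gen (Inr a))" for a
      by (rule all2[where a = a]; simp only: gen k that)+
    then show "\<psi> (clifford_gen r) = \<phi> (clifford_gen r)" for r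
      by (cases r) simp_all
  qed

  \<comment> \<open>Injectivity\<close>
  let ?g1 = "clifford_gen (Inl 1) :: (2, 2) clifford" and ?g2 = "clifford_gen (Inl 2) :: (2, 2) clifford"
  let ?g3 = "clifford_gen (Inr 1) :: (2, 2) clifford" and ?g4 = "clifford_gen (Inr 2) :: (2, 2) clifford"
  have \<phi>_carrier: "\<phi> x \<in> carrier_mat 4 4"
    and \<phi>_add: "\<phi> (x + y) = \<phi> x + \<phi> y" and \<phi>_scale: "\<phi> (c *\<^sub>R x) = c \<cdot>\<^sub>m \<phi> x"
    and \<phi>_mult: "\<phi> (x * y) = \<phi> x * \<phi> y" and \<phi>_1: "\<phi> 1 = 1\<^sub>m 4" for x y c
    using hom by (simp_all add: unital_algebra_hom_mat_def)
  have dim: "dim_row (\<phi> x) = 4" "dim_col (\<phi> x) = 4" for x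
    using \<phi>_carrier[of x] by auto
  \<comment> \<open>The signs and row numbers come from the single nonzero entry in each row of
    \<open>?M1\<close> to \<open>?M4\<close>. Since \<open>x\<close> is arbitrary, nested products
    can be evaluated from the outside inward.\<close>
  have rows:
    "\<phi> (?g1 * x) $$ (0, j) = \<phi> x $$ (2, j)" "\<phi> (?g1 * x) $$ (1, j) = \<phi> x $$ (3, j)"
    "\<phi> (?g1 * x) $$ (2, j) = \<phi> x $$ (0, j)" "\<phi> (?g1 * x) $$ (3, j) = \<phi> x $$ (1, j)"
    "\<phi> (?g2 * x) $$ (0, j) = \<phi> x $$ (0, j)" "\<phi> (?g2 * x) $$ (1, j) = \<phi> x $$ (1, j)"
    "\<phi> (?g2 * x) $$ (2, j) = - \<phi> x $$ (2, j)" "\<phi> (?g2 * x) $$ (3, j) = - \<phi> x $$ (3, j)"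
    "\<phi> (?g3 * x) $$ (0, j) = - \<phi> x $$ (3, j)" "\<phi> (?g3 * x) $$ (1, j) = - \<phi> x $$ (2, j)"
    "\<phi> (?g3 * x) $$ (2, j) = \<phi> x $$ (1, j)" "\<phi> (?g3 * x) $$ (3, j) = \<phi> x $$ (0, j)"
    "\<phi> (?g4 * x) $$ (0, j) = - \<phi> x $$ (2, j)" "\<phi> (?g4 * x) $$ (1, j) = \<phi> x $$ (3, j)"
    "\<phi> (?g4 * x) $$ (2, j) = \<phi> x $$ (0, j)" "\<phi> (?g4 * x) $$ (3, j) = - \<phi> x $$ (1, j)"
    if "j < 4" for x j
    using that \<phi>_carrier[of x]
    by (simp_all add: \<phi>_mult gen product E_index_def del: index_mult_mat(1))
  have add_index: "\<phi> (x + y) $$ (i, j) = \<phi> x $$ (i, j) + \<phi> y $$ (i, j)"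
    if "i < 4" "j < 4" for x y i j
    using that by (simp add: \<phi>_add dim)
  \<comment> \<open>Simplification turns \<open>?g4 * q1 *\<^sub>R 1\<close> into
    \<open>q1 *\<^sub>R ?g4\<close>, so entries of bare generators are needed besides
    \<open>rows\<close>.\<close>
  have generator_index: "\<phi> (clifford_gen r) $$ (i, j) = E_index (k r) i j"
    if "i < 4" "j < 4" for r i j
    using that by (simp only: gen index k_range)
  have scale_index: "\<phi> (c *\<^sub>R x) $$ (i, j) = c * \<phi> x $$ (i, j)" if "i < 4" "j < 4" for c x i j
    using that by (simp add: \<phi>_scale dim)
  have one_index: "\<phi> 1 $$ (i, j) = (if i = j then 1 else 0)" if "i < 4" "j < 4" for i j
    using that by (simp add: \<phi>_1)
  have kernel: "x = 0" if zero: "\<phi> x = 0\<^sub>m 4 4" for x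
  proof -
    have "set [Inl 1, Inl 2, Inr 1, Inr 2] = (UNIV :: (2 + 2) set)"
      by (auto simp: UNIV_sum UNIV_numeral_2)
    from clifford_in_ordered_span[OF this, of x]
    have x: "x \<in> ordered_span [?g1, ?g2, ?g3, ?g4]" by simp
    have split: "\<exists>a b. y = a + g * b \<and> a \<in> ordered_span gs \<and> b \<in> ordered_span gs"
      if "y \<in> ordered_span (g # gs)" for y g :: "(2, 2) clifford" and gs
      using that by simp
    have split_last: "\<exists>c d. y = c *\<^sub>R 1 + g * d *\<^sub>R 1" if "y \<in> ordered_span [g]"
      for y g :: "(2, 2) clifford"
      using split[OF that] unfolding ordered_span.simps by blast
    \<comment> \<open>\<open>p\<close>, \<open>q\<close>, \<open>r\<close>, \<open>s\<close> are the
      coefficients of \<open>1\<close>, \<open>?g4\<close>, \<open>?g3\<close> and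
      \<open>?g3 * ?g4\<close>.\<close>
    have two: "\<exists>p q r s. y = p *\<^sub>R 1 + ?g4 * q *\<^sub>R 1 + ?g3 * (r *\<^sub>R 1 + ?g4 * s *\<^sub>R 1)"
      if "y \<in> ordered_span [?g3, ?g4]" for y
      using split[OF that] split_last by blast
    \<comment> \<open>Below, \<open>y1\<close>, \<open>y2\<close>, \<open>y3\<close>,
      \<open>y4\<close> are the cofactors of the prefixes \<open>1\<close>, \<open>?g2\<close>,
      \<open>?g1\<close>, \<open>?g1 * ?g2\<close>. With four coefficients each, they account for
      all sixteen products.\<close>
    obtain z1 z2 where x_eq: "x = z1 + ?g1 * z2"
      and z: "z1 \<in> ordered_span [?g2, ?g3, ?g4]" "z2 \<in> ordered_span [?g2, ?g3, ?g4]"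
      using split[OF x] by blast
    obtain y1 y2 where z1: "z1 = y1 + ?g2 * y2"
      and y12: "y1 \<in> ordered_span [?g3, ?g4]" "y2 \<in> ordered_span [?g3, ?g4]"
      using split[OF z(1)] by blast
    obtain y3 y4 where z2: "z2 = y3 + ?g2 * y4"
      and y34: "y3 \<in> ordered_span [?g3, ?g4]" "y4 \<in> ordered_span [?g3, ?g4]"
      using split[OF z(2)] by blast
    obtain p1 q1 r1 s1 where y1:
      "y1 = p1 *\<^sub>R 1 + ?g4 * q1 *\<^sub>R 1 + ?g3 * (r1 *\<^sub>R 1 + ?g4 * s1 *\<^sub>R 1)"
      using two[OF y12(1)] by blast
    obtain p2 q2 r2 s2 where y2:
      "y2 = p2 *\<^sub>R 1 + ?g4 * q2 *\<^sub>R 1 + ?g3 * (r2 *\<^sub>R 1 + ?g4 * s2 *\<^sub>R 1)"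
      using two[OF y12(2)] by blast
    obtain p3 q3 r3 s3 where y3:
      "y3 = p3 *\<^sub>R 1 + ?g4 * q3 *\<^sub>R 1 + ?g3 * (r3 *\<^sub>R 1 + ?g4 * s3 *\<^sub>R 1)"
      using two[OF y34(1)] by blast
    obtain p4 q4 r4 s4 where y4:
      "y4 = p4 *\<^sub>R 1 + ?g4 * q4 *\<^sub>R 1 + ?g3 * (r4 *\<^sub>R 1 + ?g4 * s4 *\<^sub>R 1)"
      using two[OF y34(2)] by blast
    have entry: "\<phi> x $$ (i, j) = 0" if "i < 4" "j < 4" for i j
      using that by (simp add: zero)
    note entries = entry[unfolded x_eq z1 z2 y1 y2 y3 y4]
    note equations = entries[of 0 0] entries[of 0 1] entries[of 0 2] entries[of 0 3]
      entries[of 1 0] entries[of 1 1] entries[of 1 2] entries[of 1 3]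
      entries[of 2 0] entries[of 2 1] entries[of 2 2] entries[of 2 3]
      entries[of 3 0] entries[of 3 1] entries[of 3 2] entries[of 3 3]
    note equations = equations[simplified rows generator_index add_index scale_index one_index
        E_index_def k, simplified]
    \<comment> \<open>The nonzero entries of each product follow one of four permutations, which
      form a Klein four-group. The sixteen equations thus split into four systems in four unknowns,
      and each is solvable only by zero because the four sign patterns on one permutation are
      linearly independent.\<close>
    have coefficients: "p1 = 0 \<and> q1 = 0 \<and> r1 = 0 \<and> s1 = 0 \<and> p2 = 0 \<and> q2 = 0 \<and> r2 = 0 \<and> s2 = 0
      \<and> p3 = 0 \<and> q3 = 0 \<and> r3 = 0 \<and> s3 = 0 \<and> p4 = 0 \<and> q4 = 0 \<and> r4 = 0 \<and> s4 = 0"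
      using equations by (intro conjI; linarith)
    then show ?thesis by (simp add: x_eq z1 z2 y1 y2 y3 y4)
  qed
  have inj: "inj \<phi>"
  proof (rule injI)
    fix x y
    assume "\<phi> x = \<phi> y"
    have "x - y = 0"
    proof (rule kernel, rule mat4_eqI)
      \<comment> \<open>\<open>unital_algebra_hom_mat\<close> speaks of sums and scalar multiples
        only, so the difference is expressed through these.\<close>
      have "\<phi> (x - y) = \<phi> x + (- 1) \<cdot>\<^sub>m \<phi> y"
        using \<phi>_add[of x "- y"] \<phi>_scale[of "- 1" y] by simp
      then show "\<phi> (x - y) $$ (i, j) = 0\<^sub>m 4 4 $$ (i, j)"
        if "i \<in> {0, 1, 2, 3}" "j \<in> {0, 1, 2, 3}" for i j
        using that \<open>\<phi> x = \<phi> y\<close> by (auto simp: dim)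
    qed (simp_all add: \<phi>_carrier)
    then show "x = y" by simp
  qed
  have characterization: "unital_algebra_hom_mat 4 \<psi> \<and>
      \<psi> (clifford_gen (Inl 1)) = e 1 \<and> \<psi> (clifford_gen (Inl 2)) = e 2 \<and>
      \<psi> (clifford_gen (Inr 1)) = e 3 \<and> \<psi> (clifford_gen (Inr 2)) = e 4
    \<longleftrightarrow> \<psi> = \<phi>" for \<psi>
  proof
    assume "\<psi> = \<phi>"
    then show "unital_algebra_hom_mat 4 \<psi> \<and>
        \<psi> (clifford_gen (Inl 1)) = e 1 \<and> \<psi> (clifford_gen (Inl 2)) = e 2 \<and>
        \<psi> (clifford_gen (Inr 1)) = e 3 \<and> \<psi> (clifford_gen (Inr 2)) = e 4"
      by (simp only: hom gen k simp_thms)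
  qed (elim conjE, rule unique)
  show ?thesis
    by (intro conjI ballI impI exI[of _ \<phi>] allI)
      ((rule carrier squares anticommute characterization inj; assumption)+)
qed

end
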